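(* Let $\mathbf R=(R,\oplus,\cdot,0,1)$ be a ring-like structure of events (RLSE), and write $x':=x\oplus1$. Then $\mathbf R$ is a Boolean ring (with addition $\oplus$ and multiplication $\cdot$) if and only if $\mathbf R$ is weakly associative, i.e. satisfies $(x\oplus y)\oplus1=x\oplus(y\oplus1)$ for all $x,y$, and satisfies the identity $(xy'\oplus1)(x'y\oplus1)\oplus1= x\oplus y$ for all $x,y\in R$.
   Context: A ring-like structure of events (RLSE) is an algebra $(R,\oplus,\cdot,0,1)$ of type $(2,2,0,0)$ such that $(R,\cdot,1)$ is an idempotent commutative monoid with zero element $0$ (i.e. $x0=0$ for all $x$), satisfying the identities (R1) $x\oplus y= y\oplus x$; (R2) $(xy\oplus1)(x\oplus1)\oplus1= x$; (R3) $((xy\oplus1)x\oplus1)x= xy$; (R4) $xy\oplus(x\oplus1)=(xy\oplus1)x\oplus1$. *)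

theory Defs
  imports "HOL-Algebra.Ring"
begin

text \<open>An algebra of type \<open>(2,2,0,0)\<close> is a record of type \<^typ>\<open>'a ring\<close>; only its signature is
  used, no ring axioms are implied. All identities are relativised to the carrier.\<close>

locale rlse = comm_monoid R for R (structure) +
  assumes add_closed: "\<lbrakk>x \<in> carrier R; y \<in> carrier R\<rbrakk> \<Longrightarrow> x \<oplus> y \<in> carrier R"
    and zero_closed: "\<zero> \<in> carrier R"
    and mult_idem: "x \<in> carrier R \<Longrightarrow> x \<otimes> x = x"
    and mult_zero: "x \<in> carrier R \<Longrightarrow> x \<otimes> \<zero> = \<zero>"
    and R1: "\<lbrakk>x \<in> carrier R; y \<in> carrier R\<rbrakk> \<Longrightarrow> x \<oplus> y = y \<oplus> x"
    and R2: "\<lbrakk>x \<in> carrier R; y \<in> carrier R\<rbrakk> \<Longrightarrow>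
      (x \<otimes> y \<oplus> \<one>) \<otimes> (x \<oplus> \<one>) \<oplus> \<one> = x"
    and R3: "\<lbrakk>x \<in> carrier R; y \<in> carrier R\<rbrakk> \<Longrightarrow>
      ((x \<otimes> y \<oplus> \<one>) \<otimes> x \<oplus> \<one>) \<otimes> x = x \<otimes> y"
    and R4: "\<lbrakk>x \<in> carrier R; y \<in> carrier R\<rbrakk> \<Longrightarrow>
      x \<otimes> y \<oplus> (x \<oplus> \<one>) = (x \<otimes> y \<oplus> \<one>) \<otimes> x \<oplus> \<one>"

locale boolean_ring = ring R for R (structure) +
  assumes mult_idem: "x \<in> carrier R \<Longrightarrow> x \<otimes> x = x"

definition rlse_compl :: "('a, 'b) ring_scheme \<Rightarrow> 'a \<Rightarrow> 'a" where
  "rlse_compl R x = x \<oplus>\<^bsub>R\<^esub> \<one>\<^bsub>R\<^esub>"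

definition weakly_associative :: "('a, 'b) ring_scheme \<Rightarrow> bool" where
  "weakly_associative R \<longleftrightarrow> (\<forall>x\<in>carrier R. \<forall>y\<in>carrier R.
     (x \<oplus>\<^bsub>R\<^esub> y) \<oplus>\<^bsub>R\<^esub> \<one>\<^bsub>R\<^esub> = x \<oplus>\<^bsub>R\<^esub> (y \<oplus>\<^bsub>R\<^esub> \<one>\<^bsub>R\<^esub>))"

end

theory Submission
  imports Defs
begin

text \<open>
  An RLSE is an orthomodular lattice with meet \<open>xy\<close> and orthocomplement \<open>x' = x \<oplus> 1\<close>. If
  \<open>x \<oplus> y = xy' \<or> x'y\<close>, then weak associativity \<open>(x \<oplus> y)' = x \<oplus> y'\<close> says that
  \<open>xy \<or> xy' \<or> x'y \<or> x'y' = 1\<close>, which by orthomodularity forces \<open>x = xy \<or> xy'\<close>: any two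
  elements commute. Multiplication by \<open>x\<close> is then compatible with all operations, and elements
  that agree after multiplication by \<open>x\<close> and by \<open>x'\<close> are equal; so an identity may be checked
  with \<open>x\<close> replaced by \<open>1\<close> and by \<open>0\<close>, which makes \<open>\<oplus>\<close> associative and distributive.
\<close>

lemma (in comm_monoid) mult_mult_cong:
  assumes closed: "x \<in> carrier G" "a \<in> carrier G"
      "b \<in> carrier G" "c \<in> carrier G" "d \<in> carrier G"
    and left_eq: "x \<otimes> a = x \<otimes> c" and right_eq: "x \<otimes> b = x \<otimes> d"
  shows "x \<otimes> (a \<otimes> b) = x \<otimes> (c \<otimes> d)"
proof -
  have "x \<otimes> (a \<otimes> b) = (x \<otimes> a) \<otimes> b"
    using closed by (simp add: m_assoc)
  also have "\<dots> = c \<otimes> (x \<otimes> b)"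
    using closed by (simp add: left_eq m_ac)
  also have "\<dots> = x \<otimes> (c \<otimes> d)"
    using closed by (simp add: right_eq m_lcomm)
  finally show ?thesis .
qed

context rlse
begin

declare add_closed [simp] zero_closed [simp] mult_idem [simp] mult_zero [simp]

abbreviation compl :: "'a \<Rightarrow> 'a" (\<open>\<sim> _\<close> [81] 80)
  where "\<sim> x \<equiv> rlse_compl R x"

lemma compl_closed [simp]: "x \<in> carrier R \<Longrightarrow> \<sim> x \<in> carrier R"
  by (simp add: rlse_compl_def)

lemma mult_left_idem [simp]:
  "\<lbrakk>x \<in> carrier R; y \<in> carrier R\<rbrakk> \<Longrightarrow> x \<otimes> (x \<otimes> y) = x \<otimes> y"
  by (simp flip: m_assoc)

lemma zero_mult [simp]: "x \<in> carrier R \<Longrightarrow> \<zero> \<otimes> x = \<zero>"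
  by (simp add: m_comm[of \<zero>])

lemma compl_compl [simp]: "x \<in> carrier R \<Longrightarrow> \<sim> (\<sim> x) = x"
  using R2[of x \<one>] by (simp add: rlse_compl_def)

lemma compl_mult_mult_compl [simp]:
  assumes "x \<in> carrier R" "y \<in> carrier R"
  shows "\<sim> (x \<otimes> y) \<otimes> \<sim> x = \<sim> x"
proof -
  have "\<sim> (\<sim> (x \<otimes> y) \<otimes> \<sim> x) = x"
    using R2[OF assms] by (simp add: rlse_compl_def)
  then show ?thesis
    using assms compl_compl[of "\<sim> (x \<otimes> y) \<otimes> \<sim> x"] by simp
qed

lemma compl_antimono:
  assumes "x \<in> carrier R" "y \<in> carrier R" "x \<otimes> y = x"
  shows "\<sim> y \<otimes> \<sim> x = \<sim> y"
  using compl_mult_mult_compl[of y x] assms by (simp add: m_comm)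

lemma orthomodular:
  assumes "x \<in> carrier R" "y \<in> carrier R"
  shows "\<sim> (\<sim> (x \<otimes> y) \<otimes> x) \<otimes> x = x \<otimes> y"
  using R3[OF assms] by (simp add: rlse_compl_def)

lemma compl_zero [simp]: "\<sim> \<zero> = \<one>"
  using compl_mult_mult_compl[of "\<sim> \<one>" \<zero>] by simp

lemma compl_one [simp]: "\<sim> \<one> = \<zero>"
  using compl_compl[of \<zero>] by simp

lemma mult_compl_self [simp]: "x \<in> carrier R \<Longrightarrow> x \<otimes> \<sim> x = \<zero>"
  using orthomodular[of x \<zero>] by (simp add: m_comm)

lemma compl_mult_self [simp]: "x \<in> carrier R \<Longrightarrow> \<sim> x \<otimes> x = \<zero>"
  using mult_compl_self[of x] by (simp add: m_comm)

lemma eq_if_mult_compl_eq_zero: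
  assumes "a \<in> carrier R" "x \<in> carrier R" "a \<otimes> x = a" "x \<otimes> \<sim> a = \<zero>"
  shows "a = x"
  using orthomodular[of x a] assms by (simp add: m_comm)

definition join :: "'a \<Rightarrow> 'a \<Rightarrow> 'a" (infixl \<open>\<^bold>\<squnion>\<close> 65)
  where "x \<^bold>\<squnion> y = \<sim> (\<sim> x \<otimes> \<sim> y)"

lemma join_closed [simp]: "\<lbrakk>x \<in> carrier R; y \<in> carrier R\<rbrakk> \<Longrightarrow> x \<^bold>\<squnion> y \<in> carrier R"
  by (simp add: join_def)

lemma compl_join: "\<lbrakk>x \<in> carrier R; y \<in> carrier R\<rbrakk> \<Longrightarrow> \<sim> (x \<^bold>\<squnion> y) = \<sim> x \<otimes> \<sim> y"
  by (simp add: join_def)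

lemma compl_mult_eq_join:
  "\<lbrakk>x \<in> carrier R; y \<in> carrier R\<rbrakk> \<Longrightarrow> \<sim> (x \<otimes> y) = \<sim> x \<^bold>\<squnion> \<sim> y"
  by (simp add: join_def)

lemma mult_join_absorb:
  "\<lbrakk>x \<in> carrier R; y \<in> carrier R\<rbrakk> \<Longrightarrow> x \<otimes> (x \<^bold>\<squnion> y) = x"
  using compl_mult_mult_compl[of "\<sim> x" "\<sim> y"] by (simp add: join_def m_comm)

lemma join_least:
  assumes "a \<in> carrier R" "b \<in> carrier R" "x \<in> carrier R" "a \<otimes> x = a" "b \<otimes> x = b"
  shows "(a \<^bold>\<squnion> b) \<otimes> x = a \<^bold>\<squnion> b"
proof -
  have "\<sim> x \<otimes> (\<sim> a \<otimes> \<sim> b) = \<sim> x"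
    using assms by (simp add: compl_antimono flip: m_assoc)
  then show ?thesis
    using compl_antimono[of "\<sim> x" "\<sim> a \<otimes> \<sim> b"] assms by (simp add: join_def)
qed

lemma join_mult_compl_orthogonal:
  assumes "a \<in> carrier R" "b \<in> carrier R" "b \<otimes> \<sim> a = b"
  shows "(a \<^bold>\<squnion> b) \<otimes> \<sim> a = b"
  using orthomodular[of "\<sim> a" b] assms by (simp add: join_def m_comm)

definition symm_diff :: "'a \<Rightarrow> 'a \<Rightarrow> 'a" (infixl \<open>\<triangle>\<close> 65)
  where "x \<triangle> y = x \<otimes> \<sim> y \<^bold>\<squnion> \<sim> x \<otimes> y"

lemma symm_diff_closed [simp]:
  "\<lbrakk>x \<in> carrier R; y \<in> carrier R\<rbrakk> \<Longrightarrow> x \<triangle> y \<in> carrier R"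
  by (simp add: symm_diff_def)

lemma zero_symm_diff [simp]: "x \<in> carrier R \<Longrightarrow> \<zero> \<triangle> x = x"
  by (simp add: symm_diff_def join_def)

lemma one_symm_diff [simp]: "x \<in> carrier R \<Longrightarrow> \<one> \<triangle> x = \<sim> x"
  by (simp add: symm_diff_def join_def)

lemma symm_diff_self [simp]: "x \<in> carrier R \<Longrightarrow> x \<triangle> x = \<zero>"
  by (simp add: symm_diff_def join_def)

lemma compl_symm_diff_eq_mult_join:
  "\<lbrakk>x \<in> carrier R; y \<in> carrier R\<rbrakk> \<Longrightarrow> \<sim> (x \<triangle> y) = (\<sim> x \<^bold>\<squnion> y) \<otimes> (x \<^bold>\<squnion> \<sim> y)"
  by (simp add: symm_diff_def compl_join compl_mult_eq_join)

definition commutes :: "'a \<Rightarrow> 'a \<Rightarrow> bool"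
  where "commutes x y \<longleftrightarrow> x \<otimes> y \<^bold>\<squnion> x \<otimes> \<sim> y = x"

lemma mult_compl_mult_if_commutes:
  assumes x: "x \<in> carrier R" and y: "y \<in> carrier R" and "commutes x y"
  shows "x \<otimes> \<sim> (x \<otimes> y) = x \<otimes> \<sim> y"
proof -
  have "(x \<otimes> \<sim> y) \<otimes> \<sim> (x \<otimes> y) = x \<otimes> \<sim> y"
    using compl_mult_mult_compl[of y x] x y
    by (simp add: m_assoc m_comm[of y x] m_comm[of "\<sim> y"])
  then have "(x \<otimes> y \<^bold>\<squnion> x \<otimes> \<sim> y) \<otimes> \<sim> (x \<otimes> y) = x \<otimes> \<sim> y"
    using x y by (simp add: join_mult_compl_orthogonal)
  then show ?thesis
    using \<open>commutes x y\<close> by (simp add: commutes_def)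
qed

lemma commutes_if_compl_symm_diff:
  assumes x: "x \<in> carrier R" and y: "y \<in> carrier R"
    and compl_eq: "\<sim> (x \<triangle> y) = x \<triangle> \<sim> y"
  shows "commutes x y"
proof -
  let ?a = "x \<otimes> y \<^bold>\<squnion> x \<otimes> \<sim> y"
  have "?a = x"
  proof (rule eq_if_mult_compl_eq_zero)
    show "?a \<otimes> x = ?a"
      using x y by (intro join_least) (simp_all add: m_comm[of _ x])
    have "x \<otimes> \<sim> ?a = x \<otimes> ((\<sim> x \<^bold>\<squnion> \<sim> y) \<otimes> (\<sim> x \<^bold>\<squnion> y))"
      using x y by (simp add: compl_join compl_mult_eq_join)
    also have "\<dots> = (x \<otimes> (x \<^bold>\<squnion> \<sim> y)) \<otimes> (x \<otimes> (x \<^bold>\<squnion> y)) \<otimes> ((\<sim> x \<^bold>\<squnion> \<sim> y) \<otimes> (\<sim> x \<^bold>\<squnion> y))"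
      using x y by (simp add: mult_join_absorb)
    also have "\<dots> = x \<otimes> (\<sim> (x \<triangle> y) \<otimes> \<sim> (x \<triangle> \<sim> y))"
      using x y by (simp add: compl_symm_diff_eq_mult_join m_ac)
    also have "\<sim> (x \<triangle> y) \<otimes> \<sim> (x \<triangle> \<sim> y) = \<zero>"
      using x y by (simp flip: compl_eq)
    finally show "x \<otimes> \<sim> ?a = \<zero>"
      using x by simp
  qed (use x y in auto)
  then show ?thesis
    by (simp add: commutes_def)
qed

end

locale boolean_rlse = rlse +
  assumes commutes: "\<lbrakk>x \<in> carrier R; y \<in> carrier R\<rbrakk> \<Longrightarrow> commutes x y"
begin

lemma eq_if_mult_eq_compl_mult_eq:
  assumes "x \<in> carrier R" "s \<in> carrier R" "t \<in> carrier R"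
    and "x \<otimes> s = x \<otimes> t" "\<sim> x \<otimes> s = \<sim> x \<otimes> t"
  shows "s = t"
  using assms commutes[of s x] commutes[of t x] by (simp add: commutes_def m_comm)

lemma mult_compl_cong:
  assumes "x \<in> carrier R" "a \<in> carrier R" "b \<in> carrier R" "x \<otimes> a = x \<otimes> b"
  shows "x \<otimes> \<sim> a = x \<otimes> \<sim> b"
  using assms mult_compl_mult_if_commutes[of x a] mult_compl_mult_if_commutes[of x b]
  by (simp add: commutes)

lemma mult_symm_diff_cong:
  assumes "x \<in> carrier R" "a \<in> carrier R" "b \<in> carrier R" "c \<in> carrier R" "d \<in> carrier R"
    and "x \<otimes> a = x \<otimes> c" "x \<otimes> b = x \<otimes> d"
  shows "x \<otimes> (a \<triangle> b) = x \<otimes> (c \<triangle> d)"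
  unfolding symm_diff_def join_def
  using assms by (intro mult_compl_cong mult_mult_cong) auto

lemma mult_symm_diff_self:
  assumes "x \<in> carrier R" "y \<in> carrier R"
  shows "x \<otimes> (x \<triangle> y) = x \<otimes> \<sim> y"
  using mult_symm_diff_cong[of x x y \<one> y] assms by simp

lemma compl_mult_symm_diff_self:
  assumes "x \<in> carrier R" "y \<in> carrier R"
  shows "\<sim> x \<otimes> (x \<triangle> y) = \<sim> x \<otimes> y"
  using mult_symm_diff_cong[of "\<sim> x" x y \<zero> y] assms by simp

lemma compl_symm_diff_left:
  assumes x: "x \<in> carrier R" and y: "y \<in> carrier R"
  shows "\<sim> x \<triangle> y = \<sim> (x \<triangle> y)"
proof (rule eq_if_mult_eq_compl_mult_eq)
  have "x \<otimes> \<sim> (x \<triangle> y) = x \<otimes> y"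
    using mult_compl_cong[of x "x \<triangle> y" "\<sim> y"] x y by (simp add: mult_symm_diff_self)
  then show "x \<otimes> (\<sim> x \<triangle> y) = x \<otimes> \<sim> (x \<triangle> y)"
    using compl_mult_symm_diff_self[of "\<sim> x" y] x y by simp
  have "\<sim> x \<otimes> \<sim> (x \<triangle> y) = \<sim> x \<otimes> \<sim> y"
    using x y by (intro mult_compl_cong) (auto simp: compl_mult_symm_diff_self)
  then show "\<sim> x \<otimes> (\<sim> x \<triangle> y) = \<sim> x \<otimes> \<sim> (x \<triangle> y)"
    using x y by (simp add: mult_symm_diff_self)
qed (use x y in auto)

lemma symm_diff_assoc:
  assumes x: "x \<in> carrier R" and y: "y \<in> carrier R" and z: "z \<in> carrier R"
  shows "(x \<triangle> y) \<triangle> z = x \<triangle> (y \<triangle> z)"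
proof (rule eq_if_mult_eq_compl_mult_eq)
  have "x \<otimes> ((x \<triangle> y) \<triangle> z) = x \<otimes> (\<sim> y \<triangle> z)"
    using x y z by (intro mult_symm_diff_cong) (auto simp: mult_symm_diff_self)
  also have "\<dots> = x \<otimes> (x \<triangle> (y \<triangle> z))"
    using x y z by (simp add: compl_symm_diff_left mult_symm_diff_self)
  finally show "x \<otimes> ((x \<triangle> y) \<triangle> z) = x \<otimes> (x \<triangle> (y \<triangle> z))" .
  have "\<sim> x \<otimes> ((x \<triangle> y) \<triangle> z) = \<sim> x \<otimes> (y \<triangle> z)"
    using x y z by (intro mult_symm_diff_cong) (auto simp: compl_mult_symm_diff_self)
  also have "\<dots> = \<sim> x \<otimes> (x \<triangle> (y \<triangle> z))"
    using x y z by (simp add: compl_mult_symm_diff_self)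
  finally show "\<sim> x \<otimes> ((x \<triangle> y) \<triangle> z) = \<sim> x \<otimes> (x \<triangle> (y \<triangle> z))" .
qed (use x y z in auto)

lemma mult_symm_diff_distrib:
  assumes x: "x \<in> carrier R" and y: "y \<in> carrier R" and z: "z \<in> carrier R"
  shows "x \<otimes> (y \<triangle> z) = x \<otimes> y \<triangle> x \<otimes> z"
proof (rule eq_if_mult_eq_compl_mult_eq)
  have "x \<otimes> (y \<triangle> z) = x \<otimes> (x \<otimes> y \<triangle> x \<otimes> z)"
    using x y z by (intro mult_symm_diff_cong) auto
  then show "x \<otimes> (x \<otimes> (y \<triangle> z)) = x \<otimes> (x \<otimes> y \<triangle> x \<otimes> z)"
    using x y z by simp
  have vanish: "\<sim> x \<otimes> (x \<otimes> w) = \<zero>" if "w \<in> carrier R" for w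
    using x that by (simp flip: m_assoc)
  have "\<sim> x \<otimes> (x \<otimes> y \<triangle> x \<otimes> z) = \<sim> x \<otimes> (\<zero> \<triangle> \<zero>)"
    using x y z by (intro mult_symm_diff_cong) (auto simp: vanish)
  then show "\<sim> x \<otimes> (x \<otimes> (y \<triangle> z)) = \<sim> x \<otimes> (x \<otimes> y \<triangle> x \<otimes> z)"
    using x y z by (simp add: vanish)
qed (use x y z in auto)

lemma boolean_ring_if_add_eq_symm_diff:
  assumes add_eq: "\<And>x y. \<lbrakk>x \<in> carrier R; y \<in> carrier R\<rbrakk> \<Longrightarrow> x \<oplus> y = x \<triangle> y"
  shows "boolean_ring R"
proof -
  have "abelian_group R"
  proof (rule abelian_groupI)
    show "(x \<oplus> y) \<oplus> z = x \<oplus> (y \<oplus> z)"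
      if "x \<in> carrier R" "y \<in> carrier R" "z \<in> carrier R" for x y z
      using that by (simp add: add_eq symm_diff_assoc)
    show "\<zero> \<oplus> x = x" if "x \<in> carrier R" for x
      using that by (simp add: add_eq)
    show "\<exists>y\<in>carrier R. y \<oplus> x = \<zero>" if "x \<in> carrier R" for x
      using that by (intro bexI[of _ x]) (simp_all add: add_eq)
  qed (simp_all add: R1)
  moreover have "(x \<oplus> y) \<otimes> z = x \<otimes> z \<oplus> y \<otimes> z"
    if "x \<in> carrier R" "y \<in> carrier R" "z \<in> carrier R" for x y z
    using that by (simp add: add_eq mult_symm_diff_distrib m_comm[of _ z])
  ultimately have "cring R"
    using comm_monoid_axioms by (intro cringI)
  then have "ring R"
    by (rule cring.axioms)
  then show ?thesis
    by (intro boolean_ring.intro boolean_ring_axioms.intro mult_idem)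
qed

end

context boolean_ring
begin

lemma add_self:
  assumes x: "x \<in> carrier R"
  shows "x \<oplus> x = \<zero>"
proof -
  have "x \<oplus> x = (x \<oplus> x) \<otimes> (x \<oplus> x)"
    using x by (simp add: mult_idem)
  also have "\<dots> = (x \<oplus> x) \<oplus> (x \<oplus> x)"
    using x by (simp add: l_distr r_distr mult_idem[of x])
  finally have "(x \<oplus> x) \<oplus> \<zero> = (x \<oplus> x) \<oplus> (x \<oplus> x)"
    using x by simp
  then show ?thesis
    using x by simp
qed

lemma add_add_self:
  "\<lbrakk>x \<in> carrier R; y \<in> carrier R\<rbrakk> \<Longrightarrow> x \<oplus> (x \<oplus> y) = y"
  by (simp add: add_self flip: a_assoc)

lemma compl_mult_compl_eq_add:
  assumes x: "x \<in> carrier R" and y: "y \<in> carrier R"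
  shows "(x \<oplus> \<one>) \<otimes> (y \<oplus> \<one>) \<oplus> \<one> = x \<oplus> y \<oplus> x \<otimes> y"
proof -
  have "(x \<oplus> \<one>) \<otimes> (y \<oplus> \<one>) \<oplus> \<one> = x \<oplus> y \<oplus> x \<otimes> y \<oplus> (\<one> \<oplus> \<one>)"
    using x y by (simp add: l_distr r_distr a_ac)
  then show ?thesis
    using x y by (simp add: add_self)
qed

lemma xor_eq_add:
  assumes x: "x \<in> carrier R" and y: "y \<in> carrier R"
  shows "(x \<otimes> (y \<oplus> \<one>) \<oplus> \<one>) \<otimes> ((x \<oplus> \<one>) \<otimes> y \<oplus> \<one>) \<oplus> \<one> = x \<oplus> y"
proof -
  have sum_eq: "x \<otimes> (y \<oplus> \<one>) \<oplus> (x \<oplus> \<one>) \<otimes> y = x \<oplus> y"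
    using x y by (simp add: l_distr r_distr a_ac add_self add_add_self)
  have idem: "x \<otimes> (x \<otimes> y) = x \<otimes> y" "x \<otimes> y \<otimes> y = x \<otimes> y"
    using x y mult_idem by (simp_all add: m_assoc flip: m_assoc[of x x])
  have "x \<otimes> (y \<oplus> \<one>) \<otimes> ((x \<oplus> \<one>) \<otimes> y) = (x \<otimes> y \<oplus> x) \<otimes> (x \<otimes> y \<oplus> y)"
    using x y by (simp add: l_distr r_distr)
  also have "\<dots> = (x \<otimes> y \<oplus> x \<otimes> y) \<oplus> (x \<otimes> y \<oplus> x \<otimes> y)"
    using x y by (simp add: l_distr r_distr mult_idem idem)
  also have "\<dots> = \<zero>"
    using x y by (simp add: add_self)
  finally have disjoint: "x \<otimes> (y \<oplus> \<one>) \<otimes> ((x \<oplus> \<one>) \<otimes> y) = \<zero>" .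
  show ?thesis
    using x y by (simp add: compl_mult_compl_eq_add sum_eq disjoint)
qed

end

theorem theorem2p4:
  fixes R :: "('a, 'b) ring_scheme" (structure)
  assumes "rlse R"
  shows "boolean_ring R \<longleftrightarrow>
    weakly_associative R \<and>
    (\<forall>x\<in>carrier R. \<forall>y\<in>carrier R.
       (x \<otimes> rlse_compl R y \<oplus> \<one>) \<otimes> (rlse_compl R x \<otimes> y \<oplus> \<one>) \<oplus> \<one> = x \<oplus> y)"
    (is "_ \<longleftrightarrow> weakly_associative R \<and> ?xor")
proof (intro iffI conjI)
  assume "boolean_ring R"
  then interpret boolean_ring R .
  show "weakly_associative R"
    by (simp add: weakly_associative_def a_assoc)
  show ?xor
    by (simp add: rlse_compl_def xor_eq_add)
next
  interpret rlse R by fact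
  assume weak_xor: "weakly_associative R \<and> ?xor"
  then have add_eq: "x \<oplus> y = x \<triangle> y" if "x \<in> carrier R" "y \<in> carrier R" for x y
    using that by (simp add: symm_diff_def join_def rlse_compl_def)
  have "\<sim> (x \<triangle> y) = x \<triangle> \<sim> y" if "x \<in> carrier R" "y \<in> carrier R" for x y
    using weak_xor that by (simp add: weakly_associative_def rlse_compl_def flip: add_eq)
  then interpret boolean_rlse R
    by unfold_locales (simp add: commutes_if_compl_symm_diff)
  show "boolean_ring R"
    using add_eq by (rule boolean_ring_if_add_eq_symm_diff)
qed

end
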